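(* A Heisenberg orbifold $\mathcal{O}$ has a nontrivial shear in its holonomy if and only if all simple geodesics on $\mathcal{O}$ are parallel, that is, any two distinct simple geodesics on $\mathcal{O}$ are disjoint.
   Context: $\mathrm{Heis}$ is the group of real matrices $\begin{pmatrix}\pm1&a&c\\0&\pm1&b\\0&0&1\end{pmatrix}$ (signs independent, $a,b,c\in\mathbb{R}$), acting on the affine patch $\mathbb{A}^2=\{[x:y:1]\}\subset\mathbb{RP}^2$; $\mathrm{Heis}_0$ is its identity component (all signs $+1$). The Heisenberg plane is $\mathbb{H}\mathrm{s}^2=(\mathrm{Heis},\mathbb{A}^2)$. A Heisenberg orbifold is a closed 2-orbifold with a $(\mathrm{Heis},\mathbb{A}^2)$-structure, i.e. a developing pair $(f,\rho)$ with $f:\widetilde{\mathcal{O}}\to\mathbb{A}^2$ an immersion of the orbifold universal cover, equivariant with respect to the holonomy $\rho:\pi_1(\mathcal{O})\to\mathrm{Heis}$. All such structures are complete, so $\widetilde{\mathcal{O}}$ is identified with $\mathbb{A}^2$ via $f$ and $\mathcal{O}=\mathbb{A}^2/\rho(\pi_1(\mathcal{O}))$. The orbifold has a nontrivial shear in its holonomy if $\rho(\pi_1(\mathcal{O}))$ contains an element of $\mathrm{Heis}_0$ with $a\neq0$ (i.e. with nontrivial shear part; such an element need not fix a point). Geodesics are those of the affine connection: a geodesic on $\mathcal{O}$ is the image of a full straight line of $\mathbb{A}^2$, and it is simple if the lines making up its preimage in $\mathbb{A}^2$ are pairwise disjoint or equal. *)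

theory Defs
  imports "HOL-Analysis.Analysis" "HOL-Algebra.Group_Action"
begin

definition heis_matrix :: "real \<Rightarrow> real \<Rightarrow> real \<Rightarrow> real \<Rightarrow> real \<Rightarrow> real^3^3" where
  "heis_matrix s t a b c = vector [vector [s, a, c], vector [0, t, b], vector [0, 0, 1]]"

definition Heis :: "(real^3^3) monoid" where
  "Heis = \<lparr>carrier = {heis_matrix s t a b c | s t a b c. s \<in> {1, -1} \<and> t \<in> {1, -1}},
           mult = (**), one = mat 1\<rparr>"

text \<open>The identity component of \<^const>\<open>Heis\<close>.\<close>

definition Heis\<^sub>0 :: "(real^3^3) set" where
  "Heis\<^sub>0 = {heis_matrix 1 1 a b c | a b c. True}"

text \<open>The affine patch is \<open>real^2\<close>, the pair \<open>(x, y)\<close> standing for \<open>[x : y : 1]\<close>.  Matrices in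
  \<^const>\<open>Heis\<close> preserve the third homogeneous coordinate 1, so no normalisation is needed.\<close>

definition heis_act :: "real^3^3 \<Rightarrow> real^2 \<Rightarrow> real^2" where
  "heis_act A p = (let q = A *v vector [p$1, p$2, 1] in vector [q$1, q$2])"

text \<open>The quotient topology on the set of orbits of a group acting on a whole type.\<close>

definition orbit_topology ::
    "('g, 'm) monoid_scheme \<Rightarrow> ('g \<Rightarrow> 'u \<Rightarrow> 'u) \<Rightarrow> 'u::topological_space set topology" where
  "orbit_topology G \<phi> = topology (\<lambda>V. V \<subseteq> orbits G UNIV \<phi> \<and> open (orbit G \<phi> -` V))"

lemma openin_orbit_topology:
  "openin (orbit_topology G \<phi>) V \<longleftrightarrow> V \<subseteq> orbits G UNIV \<phi> \<and> open (orbit G \<phi> -` V)"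
proof -
  have "istopology (\<lambda>V. V \<subseteq> orbits G UNIV \<phi> \<and> open (orbit G \<phi> -` V))"
    unfolding istopology_def by (auto simp: vimage_Union intro: open_Int)
  then show ?thesis
    by (simp add: orbit_topology_def)
qed

lemma quotient_map_orbit: "quotient_map euclidean (orbit_topology G \<phi>) (orbit G \<phi>)"
proof -
  have "openin (orbit_topology G \<phi>) (orbits G UNIV \<phi>)"
  proof -
    have "orbit G \<phi> -` orbits G UNIV \<phi> = UNIV"
      by (auto simp: orbits_def)
    then show ?thesis
      by (simp add: openin_orbit_topology)
  qed
  then have "topspace (orbit_topology G \<phi>) = orbits G UNIV \<phi>"
    by (metis openin_orbit_topology openin_subset openin_topspace subset_antisym)
  then show ?thesis
    by (auto simp: quotient_map_def openin_orbit_topology orbits_def vimage_def)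
qed

text \<open>A closed 2-orbifold carrying a geometric structure is good, i.e. the quotient of its universal
  cover, a simply connected surface (here the type \<open>'u\<close>), by its fundamental group \<open>G\<close>, acting
  effectively and properly discontinuously by \<open>\<phi>\<close>.  The underlying space is
  \<^term>\<open>orbit_topology G \<phi>\<close>.  That \<open>'u\<close> is a surface without boundary, and that \<open>G\<close> acts smoothly
  for the structure pulled back along \<open>f\<close>, follows from \<open>immersion\<close> and \<open>equivariant\<close>: between
  surfaces, an immersion is a local homeomorphism that is smooth for the pulled back structure.
  Completeness, i.e. that \<open>f\<close> is a homeomorphism onto \<open>real^2\<close>, is a theorem and not assumed.\<close>

locale heisenberg_orbifold = faithful_action G UNIV \<phi>
  for G :: "('g, 'm) monoid_scheme" (structure)
    and \<phi> :: "'g \<Rightarrow> 'u::{t2_space, second_countable_topology} \<Rightarrow> 'u" +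
  fixes f :: "'u \<Rightarrow> real^2"
    and \<rho> :: "'g \<Rightarrow> real^3^3"
  assumes simply_connected_cover: "simply_connected (UNIV :: 'u set)"
    and continuous_action: "g \<in> carrier G \<Longrightarrow> continuous_on UNIV (\<phi> g)"
    and properly_discontinuous:
      "compact K \<Longrightarrow> finite {g \<in> carrier G. \<phi> g ` K \<inter> K \<noteq> {}}"
    and closed_orbifold: "compact_space (orbit_topology G \<phi>)"
    and immersion:
      "\<exists>V W k. open V \<and> x \<in> V \<and> open W \<and> homeomorphism V W f k"
    and holonomy: "\<rho> \<in> hom G Heis"
    and equivariant: "g \<in> carrier G \<Longrightarrow> f (\<phi> g x) = heis_act (\<rho> g) (f x)"

definition nontrivial_shear_in_holonomy ::
    "('g, 'm) monoid_scheme \<Rightarrow> ('g \<Rightarrow> real^3^3) \<Rightarrow> bool" where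
  "nontrivial_shear_in_holonomy G \<rho> \<longleftrightarrow>
     (\<exists>a b c. a \<noteq> 0 \<and> heis_matrix 1 1 a b c \<in> \<rho> ` carrier G \<inter> Heis\<^sub>0)"

definition straight_line :: "(real^2) set \<Rightarrow> bool" where
  "straight_line L \<longleftrightarrow> (\<exists>p v. v \<noteq> 0 \<and> L = range (\<lambda>t. p + t *\<^sub>R v))"

text \<open>The geodesic of the orbifold determined by a line \<open>L\<close> of the affine plane, as a set of points
  of the orbifold; the universal cover is identified with the plane via \<open>f\<close>.\<close>

definition line_image ::
    "('g, 'm) monoid_scheme \<Rightarrow> ('g \<Rightarrow> 'u \<Rightarrow> 'u) \<Rightarrow> ('u \<Rightarrow> real^2) \<Rightarrow> (real^2) set \<Rightarrow> 'u set set" where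
  "line_image G \<phi> f L = orbit G \<phi> ` (f -` L)"

text \<open>The lines making up the preimage in the plane of the geodesic determined by \<open>L\<close>.\<close>

definition preimage_lines ::
    "('g, 'm) monoid_scheme \<Rightarrow> ('g \<Rightarrow> real^3^3) \<Rightarrow> (real^2) set \<Rightarrow> (real^2) set set" where
  "preimage_lines G \<rho> L = {heis_act (\<rho> g) ` L | g. g \<in> carrier G}"

definition simple_geodesic ::
    "('g, 'm) monoid_scheme \<Rightarrow> ('g \<Rightarrow> 'u \<Rightarrow> 'u) \<Rightarrow> ('u \<Rightarrow> real^2) \<Rightarrow> ('g \<Rightarrow> real^3^3)
      \<Rightarrow> 'u set set \<Rightarrow> bool" where
  "simple_geodesic G \<phi> f \<rho> C \<longleftrightarrow>
     (\<exists>L. straight_line L \<and> C = line_image G \<phi> f L \<and> pairwise disjnt (preimage_lines G \<rho> L))"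

end

theory Submission
  imports Defs
begin

text \<open>
  Elements of the Heisenberg group permute the horizontal lines, so each horizontal line descends to a
  simple geodesic, and two of these geodesics that share a point are equal.

  If the holonomy contains an element of the identity component with \<open>a \<noteq> 0\<close>, it changes the
  direction of every line that is not horizontal, and such a line then crosses its image
  (\<open>sheared_line_meets\<close>).  So only horizontal lines give simple geodesics, and these are parallel
  (\<open>shear_imp_parallel\<close>).

  Suppose there is no such element.  The square of an element with signs \<open>(-1, -1)\<close> has shear part
  \<open>-2 a\<close>, so \<open>a = 0\<close> there as well, and products of two reflections are covered by these cases.  It
  follows that all linear parts have a common second eigendirection \<open>(k, 1)\<close>
  (\<open>no_shear_transverse_direction\<close>).  The horizontal line and the line of direction \<open>(k, 1)\<close> through
  a point \<open>f u\<close> both descend to simple geodesics, which meet at the orbit of \<open>u\<close>.  They are distinct: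
  the group is countable, because it acts properly discontinuously on a \<open>\<sigma>\<close>-compact space, so the
  translates of the transverse line meet the horizontal line in countably many points only
  (\<open>transverse_geodesics_distinct\<close>).

  Throughout, the cover and the plane are kept apart and compared by the developing map \<open>f\<close>: whether
  an orbit lies on a geodesic is decided by the developed image of one of its points
  (\<open>mem_line_image_iff\<close>), and the distinctness of the two geodesics is seen in a neighbourhood of one
  point.
\<close>

section \<open>The Heisenberg action on lines\<close>

lemma heis_act_heis_matrix:
  "heis_act (heis_matrix s t a b c) p = vector [s * p$1 + a * p$2 + c, t * p$2 + b]"
  by (simp add: heis_act_def heis_matrix_def matrix_vector_mult_def sum_3 Let_def)

lemma heis_matrix_mult:
  "heis_matrix s t a b c ** heis_matrix s' t' a' b' c' =
     heis_matrix (s * s') (t * t') (s * a' + a * t') (t * b' + b) (s * c' + a * b' + c)"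
  by (simp add: heis_matrix_def matrix_matrix_mult_def sum_3 vec_eq_iff forall_3 algebra_simps)

text \<open>The line through \<open>p\<close> with direction \<open>v\<close>; for \<open>v = 0\<close> it degenerates to the point \<open>p\<close>.\<close>

definition line :: "real^2 \<Rightarrow> real^2 \<Rightarrow> (real^2) set" where
  "line p v = range (\<lambda>t. p + t *\<^sub>R v)"

lemma base_in_line: "p \<in> line p v"
  unfolding line_def by (rule range_eqI[of _ _ 0]) simp

lemma straight_line_line: "v \<noteq> 0 \<Longrightarrow> straight_line (line p v)"
  by (auto simp: straight_line_def line_def)

lemma in_lineD: "q \<in> line p v \<Longrightarrow> \<exists>r. q$1 = p$1 + r * v$1 \<and> q$2 = p$2 + r * v$2"
  by (auto simp: line_def)

lemma line_cong:
  assumes "q \<in> line p v"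
  shows "line q v = line p v"
proof -
  obtain r where q: "q = p + r *\<^sub>R v"
    using assms by (auto simp: line_def)
  have sub: "line (x + d *\<^sub>R v) v \<subseteq> line x v" for x d
  proof
    fix y assume "y \<in> line (x + d *\<^sub>R v) v"
    then obtain t where "y = x + d *\<^sub>R v + t *\<^sub>R v"
      by (auto simp: line_def)
    then have "y = x + (d + t) *\<^sub>R v"
      by (simp add: algebra_simps)
    then show "y \<in> line x v"
      unfolding line_def by (rule range_eqI)
  qed
  have "p = q + (- r) *\<^sub>R v"
    by (simp add: q)
  then show ?thesis
    using sub[of p r] sub[of q "- r"] q by simp
qed

lemma line_scaleR:
  assumes "d \<noteq> 0"
  shows "line p (d *\<^sub>R v) = line p v"
proof -
  have "range (\<lambda>t. t * d) = UNIV"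
    using assms by (intro surjI[where f = "\<lambda>r. r / d"]) simp
  then have "line p v = (\<lambda>r. p + r *\<^sub>R v) ` range (\<lambda>t. t * d)"
    by (simp add: line_def)
  also have "\<dots> = line p (d *\<^sub>R v)"
    by (simp add: line_def image_image)
  finally show ?thesis ..
qed

lemma lines_eq_or_disjnt: "line p v = line q v \<or> disjnt (line p v) (line q v)"
  by (metis disjnt_iff line_cong)

text \<open>The hypotheses \<open>eig\<close> say that \<open>v\<close> is an eigenvector of the linear part for the eigenvalue
  \<open>e\<close>.\<close>

lemma heis_act_line:
  assumes eig: "s * v$1 + a * v$2 = e * v$1" "t * v$2 = e * v$2" and "e \<noteq> 0"
  shows "heis_act (heis_matrix s t a b c) ` line p v =
    line (heis_act (heis_matrix s t a b c) p) v"
proof -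
  let ?h = "heis_act (heis_matrix s t a b c)"
  have *: "?h (p + r *\<^sub>R v) = ?h p + (r * e) *\<^sub>R v" for r
  proof -
    have "s * (p$1 + r * v$1) + a * (p$2 + r * v$2) + c
        = s * p$1 + a * p$2 + c + r * (s * v$1 + a * v$2)"
      by (simp add: algebra_simps)
    moreover have "t * (p$2 + r * v$2) + b = t * p$2 + b + r * (t * v$2)"
      by (simp add: algebra_simps)
    ultimately show ?thesis
      by (simp add: heis_act_heis_matrix vec_eq_iff forall_2 eig)
  qed
  show ?thesis
    unfolding line_def image_image *
  proof (intro equalityI subsetI)
    fix q assume "q \<in> range (\<lambda>r. ?h p + (r * e) *\<^sub>R v)"
    then show "q \<in> range (\<lambda>r. ?h p + r *\<^sub>R v)" by auto
  next
    fix q assume "q \<in> range (\<lambda>r. ?h p + r *\<^sub>R v)"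
    then obtain r where "q = ?h p + r *\<^sub>R v" by auto
    then have "q = ?h p + ((r / e) * e) *\<^sub>R v" using \<open>e \<noteq> 0\<close> by simp
    then show "q \<in> range (\<lambda>r. ?h p + (r * e) *\<^sub>R v)" by (rule range_eqI)
  qed
qed

text \<open>A nontrivial shear changes the direction of every line that is not horizontal, so the line and
  its image are not parallel.\<close>

lemma sheared_line_meets:
  assumes "a \<noteq> 0" "v$2 \<noteq> 0"
  shows "\<not> disjnt (heis_act (heis_matrix 1 1 a b c) ` line p v) (line p v)"
    and "heis_act (heis_matrix 1 1 a b c) ` line p v \<noteq> line p v"
proof -
  let ?h = "heis_act (heis_matrix 1 1 a b c)"
  \<comment> \<open>The parameter whose image point lies on the line again: the image has height
    \<open>p$2 + r * v$2 + b\<close>, so it must be the point with parameter \<open>r + b / v$2\<close>, and comparing first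
    coordinates determines \<open>r\<close>.\<close>
  define r where "r = (b * v$1 / v$2 - c) / (a * v$2) - p$2 / v$2"
  have "a * (p$2 + r * v$2) = b * v$1 / v$2 - c"
    using assms by (simp add: r_def field_simps)
  then have "?h (p + r *\<^sub>R v) = p + (r + b / v$2) *\<^sub>R v"
    using assms by (simp add: heis_act_heis_matrix vec_eq_iff forall_2 field_simps)
  then have "?h (p + r *\<^sub>R v) \<in> line p v"
    by (auto simp: line_def)
  moreover have "?h (p + r *\<^sub>R v) \<in> ?h ` line p v"
    by (auto simp: line_def)
  ultimately show "\<not> disjnt (?h ` line p v) (line p v)"
    unfolding disjnt_iff by blast
  show "?h ` line p v \<noteq> line p v"
  proof
    assume eq: "?h ` line p v = line p v"
    have "p \<in> line p v" "p + v \<in> line p v"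
      using base_in_line[of p v] rangeI[of "\<lambda>t. p + t *\<^sub>R v" 1] by (auto simp: line_def)
    then have "?h p \<in> line p v" "?h (p + v) \<in> line p v"
      using eq by blast+
    from this[THEN in_lineD] obtain r\<^sub>1 r\<^sub>2 where
      r1: "p$1 + a * p$2 + c = p$1 + r\<^sub>1 * v$1" "p$2 + b = p$2 + r\<^sub>1 * v$2" and
      r2: "p$1 + v$1 + a * (p$2 + v$2) + c = p$1 + r\<^sub>2 * v$1"
          "p$2 + v$2 + b = p$2 + r\<^sub>2 * v$2"
      by (auto simp: heis_act_heis_matrix)
    have "r\<^sub>2 * v$2 = (r\<^sub>1 + 1) * v$2"
      using r1(2) r2(2) by (simp add: algebra_simps)
    then have "r\<^sub>2 = r\<^sub>1 + 1"
      using assms(2) by simp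
    then have "r\<^sub>2 * v$1 = r\<^sub>1 * v$1 + v$1"
      by (simp add: distrib_right)
    then have "a * v$2 = 0"
      using r1(1) r2(1) distrib_left[of a "p$2" "v$2"] by linarith
    with assms show False by simp
  qed
qed

section \<open>Geodesics on a Heisenberg orbifold\<close>

context heisenberg_orbifold
begin

lemma holonomyE:
  assumes "g \<in> carrier G"
  obtains s t a b c where "\<rho> g = heis_matrix s t a b c" "s \<in> {1, -1}" "t \<in> {1, -1}"
  using hom_in_carrier[OF holonomy assms] by (auto simp: Heis_def)

lemma holonomy_mult:
  "g \<in> carrier G \<Longrightarrow> h \<in> carrier G \<Longrightarrow> \<rho> (g \<otimes> h) = \<rho> g ** \<rho> h"
  using hom_mult[OF holonomy] by (simp add: Heis_def)

lemma heis_act_holonomy_mult: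
  assumes "g \<in> carrier G" "h \<in> carrier G"
  shows "heis_act (\<rho> (g \<otimes> h)) p = heis_act (\<rho> g) (heis_act (\<rho> h) p)"
proof -
  obtain s t a b c where g: "\<rho> g = heis_matrix s t a b c"
    using holonomyE[OF assms(1)] by metis
  obtain s' t' a' b' c' where h: "\<rho> h = heis_matrix s' t' a' b' c'"
    using holonomyE[OF assms(2)] by metis
  show ?thesis
    by (simp add: holonomy_mult assms g h heis_matrix_mult heis_act_heis_matrix vec_eq_iff
        forall_2 algebra_simps)
qed

lemma group_G: "group G"
  using group_hom by (simp add: group_hom_def)

lemma heis_act_holonomy_one: "heis_act (\<rho> \<one>) p = p"
proof -
  have one: "\<one> \<in> carrier G" "\<one> \<otimes> \<one> = \<one>"
    using group_G by (simp_all add: group.is_monoid)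
  obtain s t a b c where h: "\<rho> \<one> = heis_matrix s t a b c" "s \<in> {1, -1}" "t \<in> {1, -1}"
    using holonomyE[OF one(1)] .
  \<comment> \<open>The holonomy of the unit is an idempotent injective map, hence the identity.\<close>
  have "heis_act (\<rho> \<one>) (heis_act (\<rho> \<one>) p) = heis_act (\<rho> \<one>) p"
    using heis_act_holonomy_mult[OF one(1) one(1), of p] one(2) by simp
  then show ?thesis
    using h(2,3) unfolding h(1) by (auto simp: heis_act_heis_matrix vec_eq_iff forall_2)
qed

lemma heis_act_holonomy_inv:
  assumes "g \<in> carrier G"
  shows "heis_act (\<rho> (inv g)) (heis_act (\<rho> g) p) = p"
  using heis_act_holonomy_mult[of "inv g" g p] assms group_G heis_act_holonomy_one
  by (simp add: group.inv_closed group.l_inv)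

text \<open>Membership of an orbit in a geodesic can be tested on any chosen representative \<open>u\<close> of the
  orbit, at the price of moving the line by the holonomy.\<close>

lemma mem_line_image_iff:
  "orbit G \<phi> u \<in> line_image G \<phi> f L \<longleftrightarrow> (\<exists>g\<in>carrier G. f u \<in> heis_act (\<rho> g) ` L)"
proof
  assume "orbit G \<phi> u \<in> line_image G \<phi> f L"
  then obtain y where y: "f y \<in> L" "orbit G \<phi> u = orbit G \<phi> y"
    by (auto simp: line_image_def)
  moreover have "u \<in> orbit G \<phi> u"
    by (simp add: orbit_refl)
  ultimately obtain g where "g \<in> carrier G" "u = \<phi> g y"
    by (auto simp: orbit_def)
  with y(1) show "\<exists>g\<in>carrier G. f u \<in> heis_act (\<rho> g) ` L"
    by (auto simp: equivariant)
next
  assume "\<exists>g\<in>carrier G. f u \<in> heis_act (\<rho> g) ` L"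
  then obtain g p where g: "g \<in> carrier G" and p: "p \<in> L" "f u = heis_act (\<rho> g) p"
    by auto
  define y where "y = \<phi> (inv g) u"
  have ig: "inv g \<in> carrier G"
    using g group_G by (simp add: group.inv_closed)
  have "f y = p"
    using equivariant[OF ig] p(2) heis_act_holonomy_inv[OF g] by (simp add: y_def)
  moreover have "orbit G \<phi> u = orbit G \<phi> y"
  proof -
    have y: "y \<in> orbit G \<phi> u"
      using ig by (auto simp: y_def orbit_def)
    have "u \<in> orbit G \<phi> y"
      using orbit_sym[OF UNIV_I UNIV_I y] .
    with y show ?thesis
      using orbit_trans[OF UNIV_I UNIV_I UNIV_I] by blast
  qed
  ultimately show "orbit G \<phi> u \<in> line_image G \<phi> f L"
    using p(1) by (auto simp: line_image_def)
qed

lemma line_image_holonomy: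
  assumes g: "g \<in> carrier G"
  shows "line_image G \<phi> f (heis_act (\<rho> g) ` L) = line_image G \<phi> f L"
proof -
  have ig: "inv g \<in> carrier G"
    using g group_G by (simp add: group.inv_closed)
  have sub: "line_image G \<phi> f (heis_act (\<rho> h) ` M) \<subseteq> line_image G \<phi> f M"
    if h: "h \<in> carrier G" for h M
  proof
    fix X assume X: "X \<in> line_image G \<phi> f (heis_act (\<rho> h) ` M)"
    then obtain u where u: "X = orbit G \<phi> u"
      by (auto simp: line_image_def)
    with X obtain k where k: "k \<in> carrier G" "f u \<in> heis_act (\<rho> k) ` heis_act (\<rho> h) ` M"
      by (auto simp: mem_line_image_iff)
    then have "f u \<in> heis_act (\<rho> (k \<otimes> h)) ` M"
      by (auto simp: heis_act_holonomy_mult h)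
    moreover have "k \<otimes> h \<in> carrier G"
      using k h group_G by (simp add: group.is_monoid monoid.m_closed)
    ultimately show "X \<in> line_image G \<phi> f M"
      by (auto simp: u mem_line_image_iff)
  qed
  have "heis_act (\<rho> (inv g)) ` heis_act (\<rho> g) ` L = L"
    by (simp add: image_image heis_act_holonomy_inv g)
  then show ?thesis
    using sub[OF g, of L] sub[OF ig, of "heis_act (\<rho> g) ` L"] by auto
qed

text \<open>A direction is invariant when the holonomy maps lines with this direction to lines with the
  same direction.  The definition speaks of the lines rather than of eigenvectors of the linear
  parts, since only the images of the lines matter for simplicity.\<close>

definition invariant_direction :: "real^2 \<Rightarrow> bool" where
  "invariant_direction v \<longleftrightarrow>
     (\<forall>g\<in>carrier G. \<forall>p. heis_act (\<rho> g) ` line p v = line (heis_act (\<rho> g) p) v)"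

lemma simple_geodesic_invariant_direction:
  assumes "invariant_direction v" "v \<noteq> 0"
  shows "simple_geodesic G \<phi> f \<rho> (line_image G \<phi> f (line p v))"
proof -
  have "\<exists>q. M = line q v" if "M \<in> preimage_lines G \<rho> (line p v)" for M
    using assms(1) that unfolding invariant_direction_def preimage_lines_def by blast
  then have "pairwise disjnt (preimage_lines G \<rho> (line p v))"
    using lines_eq_or_disjnt unfolding pairwise_def by metis
  then show ?thesis
    using straight_line_line[OF assms(2)] by (auto simp: simple_geodesic_def)
qed

lemma horizontal_invariant:
  assumes "v$2 = 0"
  shows "invariant_direction v"
  unfolding invariant_direction_def
proof (intro ballI allI)
  fix g p assume "g \<in> carrier G"
  then obtain s t a b c where "\<rho> g = heis_matrix s t a b c" "s \<in> {1, -1}"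
    by (metis holonomyE)
  moreover from this(2) have "s \<noteq> 0"
    by auto
  ultimately show "heis_act (\<rho> g) ` line p v = line (heis_act (\<rho> g) p) v"
    using heis_act_line[of s v a s t b c p] assms by simp
qed

section \<open>Holonomy with a shear\<close>

lemma simple_geodesic_horizontal:
  assumes "nontrivial_shear_in_holonomy G \<rho>" "simple_geodesic G \<phi> f \<rho> C"
  obtains p where "C = line_image G \<phi> f (line p (vector [1, 0]))"
proof -
  obtain g a b c where g: "g \<in> carrier G" "\<rho> g = heis_matrix 1 1 a b c" "a \<noteq> 0"
    using assms(1) by (auto simp: nontrivial_shear_in_holonomy_def) metis
  obtain p v where v: "v \<noteq> 0" and C: "C = line_image G \<phi> f (line p v)"
    and pw: "pairwise disjnt (preimage_lines G \<rho> (line p v))"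
    using assms(2) by (auto simp: simple_geodesic_def straight_line_def line_def)
  have "heis_act (\<rho> \<one>) ` line p v \<in> preimage_lines G \<rho> (line p v)"
    using group_G by (auto simp: preimage_lines_def group.is_monoid)
  then have "line p v \<in> preimage_lines G \<rho> (line p v)"
    by (simp add: heis_act_holonomy_one)
  moreover have "heis_act (\<rho> g) ` line p v \<in> preimage_lines G \<rho> (line p v)"
    using g(1) by (auto simp: preimage_lines_def)
  ultimately have "v$2 = 0"
    using pw sheared_line_meets[OF g(3), of v b c p] unfolding pairwise_def g(2) by blast
  then have "v = v$1 *\<^sub>R vector [1, 0]" and v1: "v$1 \<noteq> 0"
    using v by (simp_all add: vec_eq_iff forall_2)
  then have "line p v = line p (vector [1, 0])"
    using line_scaleR[OF v1] by metis
  with C that show ?thesis by simp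
qed

lemma shear_imp_parallel:
  assumes shear: "nontrivial_shear_in_holonomy G \<rho>"
    and C: "simple_geodesic G \<phi> f \<rho> C" and D: "simple_geodesic G \<phi> f \<rho> D"
    and meet: "C \<inter> D \<noteq> {}"
  shows "C = D"
proof -
  let ?e = "vector [1, 0] :: real^2"
  obtain p where p: "C = line_image G \<phi> f (line p ?e)"
    using simple_geodesic_horizontal[OF shear C] .
  obtain q where q: "D = line_image G \<phi> f (line q ?e)"
    using simple_geodesic_horizontal[OF shear D] .
  obtain u where u: "f u \<in> line p ?e" "orbit G \<phi> u \<in> D"
    using meet p by (auto simp: line_image_def)
  then obtain g where g: "g \<in> carrier G" "f u \<in> heis_act (\<rho> g) ` line q ?e"
    by (auto simp: q mem_line_image_iff)
  have "heis_act (\<rho> g) ` line q ?e = line (heis_act (\<rho> g) q) ?e"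
    using horizontal_invariant[of ?e] g(1) by (simp add: invariant_direction_def)
  then have "heis_act (\<rho> g) ` line q ?e = line p ?e"
    using u(1) g(2) by (metis line_cong)
  then show ?thesis
    using p q line_image_holonomy[OF g(1)] by metis
qed

section \<open>Holonomy without shears\<close>

text \<open>Without shears every linear part squares to the identity, and all linear parts are diagonal in
  one basis whose first vector is horizontal.  In the basis of \<open>(1, 0)\<close> and \<open>(k, 1)\<close> the linear part
  with signs \<open>s\<close>, \<open>t\<close> and shear part \<open>a\<close> is diagonal if and only if \<open>s * k + a = t * k\<close>.\<close>

lemma no_shear_transverse_direction:
  assumes no_shear: "\<not> nontrivial_shear_in_holonomy G \<rho>"
  obtains k where "invariant_direction (vector [k, 1])"
proof -
  have pos: "a = 0" if "g \<in> carrier G" "\<rho> g = heis_matrix 1 1 a b c" for g a b c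
    using no_shear that
    by (force simp: nontrivial_shear_in_holonomy_def Heis\<^sub>0_def image_iff)
  have prod: "s * a' + a * t' = 0"
    if "g \<in> carrier G" "\<rho> g = heis_matrix s t a b c" "h \<in> carrier G"
      "\<rho> h = heis_matrix s' t' a' b' c'" "s * s' = 1" "t * t' = 1" for g h s t a b c s' t' a' b' c'
    using pos[of "g \<otimes> h"] that holonomy_mult[of g h] group_G
    by (simp add: heis_matrix_mult group.is_monoid monoid.m_closed)
  have neg: "a = 0" if "g \<in> carrier G" "\<rho> g = heis_matrix (-1) (-1) a b c" for g a b c
    using prod[OF that that] by simp
  have prod_neg: "s * a' + a * t' = 0"
    if "g \<in> carrier G" "\<rho> g = heis_matrix s t a b c" "h \<in> carrier G"
      "\<rho> h = heis_matrix s' t' a' b' c'" "s * s' = -1" "t * t' = -1"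
    for g h s t a b c s' t' a' b' c'
    using neg[of "g \<otimes> h"] that holonomy_mult[of g h] group_G
    by (simp add: heis_matrix_mult group.is_monoid monoid.m_closed)
  obtain k where k: "s * k + a = t * k"
    if "g \<in> carrier G" "\<rho> g = heis_matrix s t a b c" "s \<in> {1, -1}" "t \<in> {1, -1}" "s \<noteq> t"
    for g s t a b c
  proof (cases "\<exists>g\<in>carrier G. \<exists>s a b c. \<rho> g = heis_matrix s (-s) a b c \<and> s \<in> {1, -1}")
    case True
    then obtain h \<sigma> \<alpha> \<beta> \<gamma> where h: "h \<in> carrier G" "\<rho> h = heis_matrix \<sigma> (-\<sigma>) \<alpha> \<beta> \<gamma>" "\<sigma> \<in> {1, -1}"
      by blast
    \<comment> \<open>With this choice of \<open>k\<close> the vector \<open>(k, 1)\<close> is an eigenvector of the linear part of \<open>\<rho> h\<close> for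
      the eigenvalue \<open>-\<sigma>\<close>.\<close>
    show thesis
    proof (rule that[of "- \<alpha> / (2 * \<sigma>)"])
      fix g s t a b c
      assume g: "g \<in> carrier G" "\<rho> g = heis_matrix s t a b c" "s \<in> {1, -1}" "t \<in> {1, -1}" "s \<noteq> t"
      then have t: "t = -s" by auto
      have "\<sigma> * a + \<alpha> * t = 0"
        using prod[OF h(1,2) g(1,2)] prod_neg[OF h(1,2) g(1,2)] h(3) g(3) t by auto
      then show "s * (- \<alpha> / (2 * \<sigma>)) + a = t * (- \<alpha> / (2 * \<sigma>))"
        using h(3) g(3) t by auto
    qed
  next
    case False
    show thesis
    proof (rule that[of 0])
      fix g s t a b c
      assume g: "g \<in> carrier G" "\<rho> g = heis_matrix s t a b c" "s \<in> {1, -1}" "t \<in> {1, -1}" "s \<noteq> t"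
      then have "t = -s" by auto
      then show "s * 0 + a = t * 0"
        using False g by blast
    qed
  qed
  have "invariant_direction (vector [k, 1])"
    unfolding invariant_direction_def
  proof (intro ballI allI)
    fix g p assume g: "g \<in> carrier G"
    obtain s t a b c where h: "\<rho> g = heis_matrix s t a b c" "s \<in> {1, -1}" "t \<in> {1, -1}"
      using holonomyE[OF g] .
    have "s * k + a = t * k"
    proof (cases "s = t")
      case True
      then have "a = 0" using pos[OF g] neg[OF g] h by auto
      with True show ?thesis by simp
    next
      case False
      with k[OF g h] show ?thesis by simp
    qed
    moreover have "t \<noteq> 0"
      using h(3) by auto
    ultimately show "heis_act (\<rho> g) ` line p (vector [k, 1]) =
        line (heis_act (\<rho> g) p) (vector [k, 1])"
      using heis_act_line[of s "vector [k, 1]" a t t b c p] by (simp add: h(1))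
  qed
  with that show thesis .
qed

lemma compact_neighbourhood:
  obtains S K where "open S" "u \<in> S" "S \<subseteq> K" "compact (K :: 'u set)"
proof -
  obtain V W k where V: "open V" "u \<in> V" "open W" and hom: "homeomorphism V W f k"
    using immersion by blast
  have "f u \<in> W"
    using hom V(2) by (auto simp: homeomorphism_def)
  then obtain e where e: "e > 0" "cball (f u) e \<subseteq> W"
    using V(3) open_contains_cball by blast
  have "open (V \<inter> f -` ball (f u) e)"
    using hom V(1) by (intro continuous_open_preimage) (auto simp: homeomorphism_def)
  moreover have "V \<inter> f -` ball (f u) e \<subseteq> k ` cball (f u) e"
  proof
    fix x assume x: "x \<in> V \<inter> f -` ball (f u) e"
    then have "x = k (f x)"
      using hom by (simp add: homeomorphism_def)
    with x show "x \<in> k ` cball (f u) e"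
      by (metis IntD2 ball_subset_cball image_eqI subsetD vimageE)
  qed
  moreover have "compact (k ` cball (f u) e)"
    using hom e(2) continuous_on_subset
    by (intro compact_continuous_image) (auto simp: homeomorphism_def)
  ultimately show ?thesis
    using that[of "V \<inter> f -` ball (f u) e" "k ` cball (f u) e"] V(2) e(1) by auto
qed

text \<open>The cover is a countable union of compact sets, and each of them contains only finitely many
  translates of a given point.\<close>

lemma countable_group: "countable (carrier G)"
proof -
  let ?F = "{S :: 'u set. open S \<and> (\<exists>K. S \<subseteq> K \<and> compact K)}"
  obtain F where F: "F \<subseteq> ?F" "countable F" "\<Union>F = \<Union>?F"
    using Lindelof[of ?F] by blast
  have cover: "x \<in> \<Union>?F" for x
    by (rule compact_neighbourhood[of x]) blast
  fix u :: 'u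
  have "countable {g \<in> carrier G. \<phi> g u \<in> S}" if S: "S \<in> F" for S
  proof -
    obtain K where K: "S \<subseteq> K" "compact K"
      using S F(1) by auto
    have "finite {g \<in> carrier G. \<phi> g ` insert u K \<inter> insert u K \<noteq> {}}"
      using K(2) by (intro properly_discontinuous) simp
    then have "finite {g \<in> carrier G. \<phi> g u \<in> S}"
      by (rule rev_finite_subset) (use K(1) in auto)
    then show ?thesis
      by (rule countable_finite)
  qed
  then have "countable (\<Union>S\<in>F. {g \<in> carrier G. \<phi> g u \<in> S})"
    using F(2) by blast
  moreover have "carrier G \<subseteq> (\<Union>S\<in>F. {g \<in> carrier G. \<phi> g u \<in> S})"
  proof
    fix g assume "g \<in> carrier G"
    moreover obtain S where "S \<in> F" "\<phi> g u \<in> S"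
      using cover[of "\<phi> g u"] unfolding F(3)[symmetric] by (elim UnionE)
    ultimately show "g \<in> (\<Union>S\<in>F. {g \<in> carrier G. \<phi> g u \<in> S})"
      by blast
  qed
  ultimately show ?thesis
    by (rule countable_subset[rotated])
qed

text \<open>If the geodesics were equal, then each point of a horizontal segment at \<open>f u\<close>, short enough to
  lift to the cover, would lie on one of the countably many translates of the transverse line.  But
  each translate contains at most one such point.\<close>

lemma transverse_geodesics_distinct:
  fixes u :: 'u
  assumes inv: "invariant_direction (vector [k, 1])"
  shows "line_image G \<phi> f (line (f u) (vector [1, 0])) \<noteq>
    line_image G \<phi> f (line (f u) (vector [k, 1]))"
proof
  let ?e = "vector [1, 0] :: real^2" and ?w = "vector [k, 1] :: real^2"
  assume eq: "line_image G \<phi> f (line (f u) ?e) = line_image G \<phi> f (line (f u) ?w)"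
  obtain V W j where V: "open V" "u \<in> V" "open W" and hom: "homeomorphism V W f j"
    using immersion by blast
  have "f u \<in> W"
    using hom V(2) by (auto simp: homeomorphism_def)
  then obtain e where e: "e > 0" "cball (f u) e \<subseteq> W"
    using V(3) open_contains_cball by blast
  let ?P = "\<lambda>r. f u + r *\<^sub>R ?e"
  have norm_e: "norm ?e = 1"
    by (simp add: norm_vec_def L2_set_def sum_2)
  \<comment> \<open>The image under \<open>\<rho> g\<close> of the transverse line through \<open>f u\<close> meets the horizontal line through
    \<open>f u\<close> only at the parameter \<open>m g\<close>.\<close>
  define m where "m g = (let q = heis_act (\<rho> g) (f u) in
    q$1 - (f u)$1 + k * ((f u)$2 - q$2))" for g
  have "{0..e} \<subseteq> m ` carrier G"
  proof
    fix r assume r: "r \<in> {0..e}"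
    then have "?P r \<in> W"
      using e(2) norm_e by (auto simp: dist_norm)
    then obtain x where x: "f x = ?P r"
      using hom by (auto simp: homeomorphism_def)
    then have "f x \<in> line (f u) ?e"
      by (auto simp: line_def)
    then have "orbit G \<phi> x \<in> line_image G \<phi> f (line (f u) ?e)"
      by (auto simp: line_image_def)
    then obtain g where g: "g \<in> carrier G" "f x \<in> heis_act (\<rho> g) ` line (f u) ?w"
      unfolding eq mem_line_image_iff by blast
    then have "f x \<in> line (heis_act (\<rho> g) (f u)) ?w"
      using inv by (simp add: invariant_direction_def)
    then have "r = m g"
      by (auto dest!: in_lineD simp: x m_def Let_def algebra_simps)
    with g(1) show "r \<in> m ` carrier G"
      by blast
  qed
  then have "countable {0..e}"
    by (rule countable_subset[OF _ countable_image[OF countable_group]])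
  then show False
    using uncountable_closed_interval[of 0 e] e(1) by simp
qed

lemma no_shear_imp_crossing:
  assumes "\<not> nontrivial_shear_in_holonomy G \<rho>"
  obtains C D where "simple_geodesic G \<phi> f \<rho> C" "simple_geodesic G \<phi> f \<rho> D" "C \<noteq> D" "C \<inter> D \<noteq> {}"
proof -
  obtain k where k: "invariant_direction (vector [k, 1])"
    using no_shear_transverse_direction[OF assms] .
  fix u :: 'u
  let ?C = "line_image G \<phi> f (line (f u) (vector [1, 0]))"
    and ?D = "line_image G \<phi> f (line (f u) (vector [k, 1]))"
  have nz: "(vector [1, 0] :: real^2) \<noteq> 0" "(vector [k, 1] :: real^2) \<noteq> 0"
    by (auto simp: vec_eq_iff forall_2)
  have "orbit G \<phi> u \<in> ?C \<inter> ?D"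
    using base_in_line by (auto simp: line_image_def)
  moreover have "simple_geodesic G \<phi> f \<rho> ?C" "simple_geodesic G \<phi> f \<rho> ?D"
    using simple_geodesic_invariant_direction[OF horizontal_invariant nz(1)]
      simple_geodesic_invariant_direction[OF k nz(2)] by simp_all
  ultimately show thesis
    using that transverse_geodesics_distinct[OF k] by blast
qed

end

section \<open>Shears and parallel simple geodesics\<close>

theorem theorem1p6:
  fixes G :: "('g, 'm) monoid_scheme"
    and \<phi> :: "'g \<Rightarrow> 'u::{t2_space, second_countable_topology} \<Rightarrow> 'u"
    and f :: "'u \<Rightarrow> real^2"
    and \<rho> :: "'g \<Rightarrow> real^3^3"
  assumes "heisenberg_orbifold G \<phi> f \<rho>"
  shows "nontrivial_shear_in_holonomy G \<rho> \<longleftrightarrow>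
    (\<forall>C D. simple_geodesic G \<phi> f \<rho> C \<and> simple_geodesic G \<phi> f \<rho> D \<and> C \<noteq> D \<longrightarrow> C \<inter> D = {})"
proof -
  interpret heisenberg_orbifold G \<phi> f \<rho>
    by (fact assms)
  show ?thesis
    using shear_imp_parallel no_shear_imp_crossing by metis
qed

end
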